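(* Let $\star_1\in\{0^+\cdot\infty,0\cdot\infty^-\}$, $\star_2\in\{\infty\cdot0^+,\infty^-\cdot0\}$, let the positive Markov process $X$ be in $(\star_1,\star_2)$-Laplace duality with the positive Markov process $Y$, and let $\theta\in[0,\infty)$. If $\mu$ is a $\theta$-excessive (resp. $\theta$-invariant) measure for $Y$, then the functions $f^\downarrow,f^\uparrow$ defined on $[0,\infty]$ by (with $\star_1,\star_2$ in force) $$f^\downarrow(x):=\int e^{-xy}\,\mu(\mathrm{d}y)\quad\text{and}\quad f^\uparrow(x):=\int(1-e^{-xy})\,\mu(\mathrm{d}y),\qquad x\in[0,\infty],$$ are, respectively, nonincreasing and nondecreasing, $\theta$-excessive (resp. $\theta$-invariant) functions for $X$.
   Context: Positive Markov process: a time-homogeneous Markov process with values in $[0,\infty]$ (Borel $\sigma$-field), under probabilities $(\mathbb{P}_x)_{x\in[0,\infty]}$ on a common measurable space, with $x\mapsto\mathbb{P}_x(X_t\in A)$ Borel, $\mathbb{P}_x(X_0=x)=1$ and the Markov property; no path regularity is assumed. $P_tf(x)=\mathbb{E}_x[f(X_t)]$ denotes its semigroup; for $Y$ laws and expectations are written $\mathbb{P}^y,\mathbb{E}^y$ and the semigroup $Q_t$. Conventions: $e^{-\infty}=0$, and $x\cdot\infty=\infty\cdot x=\infty$ for $x\in(0,\infty]$. Under $0^+\cdot\infty$ one interprets $e^{-0\cdot\infty}=0$; under $0\cdot\infty^-$, $e^{-0\cdot\infty}=1$; under $\infty\cdot 0^+$, $e^{-\infty\cdot 0}=0$; under $\infty^-\cdot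 0$, $e^{-\infty\cdot 0}=1$. In products the first factor refers to the $X$-variable and the second to the $Y$-variable. $X$ is in $(\star_1,\star_2)$-Laplace duality with $Y$ if $\mathbb{E}_x[e^{-X_ty}]=\mathbb{E}^y[e^{-xY_t}]$ for all $t\in[0,\infty)$, $(x,y)\in[0,\infty]^2$, under these conventions. A $\theta$-excessive (resp. $\theta$-invariant) measure for $Y$ is a $\sigma$-finite measure $\mu$ on the Borel sets of $[0,\infty]$ such that for all $t\in[0,\infty)$ and all Borel $\varphi:[0,\infty]\to[0,\infty]$, $\int Q_t\varphi\,\mathrm{d}\mu\le e^{\theta t}\int\varphi\,\mathrm{d}\mu$ (resp. with equality). A $\theta$-excessive (resp. $\theta$-invariant) function for $X$ is a Borel map $f:[0,\infty]\to[0,\infty]$ such that $P_tf\le e^{\theta t}f$ (resp. $P_tf=e^{\theta t}f$) for all $t\in[0,\infty)$. *)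

theory Defs
  imports "HOL-Probability.Probability"
begin

text \<open>
  The state space \<open>[0,\<infinity>]\<close> is the type \<^typ>\<open>ennreal\<close> with its Borel \<open>\<sigma>\<close>-field; times in
  \<open>[0,\<infinity>)\<close> are reals \<open>t\<close> with \<open>0 \<le> t\<close>. A process consists of a measurable space \<open>M\<close> (the measure
  carried by \<open>M\<close> is irrelevant), probabilities \<open>P x\<close> on it, and the random variables \<open>X t\<close>.
\<close>

definition natural_filtration ::
  "'a measure \<Rightarrow> (real \<Rightarrow> 'a \<Rightarrow> ennreal) \<Rightarrow> real \<Rightarrow> 'a measure" where
  "natural_filtration M X s =
     sigma (space M) {X u -` A \<inter> space M | u A. 0 \<le> u \<and> u \<le> s \<and> A \<in> sets borel}"

locale positive_markov_process =
  fixes M :: "'a measure"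
    and P :: "ennreal \<Rightarrow> 'a measure"
    and X :: "real \<Rightarrow> 'a \<Rightarrow> ennreal"
  assumes prob_space_P: "\<And>x. prob_space (P x)"
    and sets_P: "\<And>x. sets (P x) = sets M"
    and measurable_X: "\<And>t. 0 \<le> t \<Longrightarrow> X t \<in> measurable M borel"
    and measurable_start: "\<And>t A. 0 \<le> t \<Longrightarrow> A \<in> sets borel \<Longrightarrow>
          (\<lambda>x. emeasure (P x) (X t -` A \<inter> space M)) \<in> borel_measurable borel"
    and start: "\<And>x. emeasure (P x) {\<omega> \<in> space M. X 0 \<omega> = x} = 1"
    and markov: "\<And>x s t A. 0 \<le> s \<Longrightarrow> 0 \<le> t \<Longrightarrow> A \<in> sets borel \<Longrightarrow>
          AE \<omega> in P x.
            nn_cond_exp (P x) (natural_filtration M X s)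
              (indicator (X (s + t) -` A \<inter> space M)) \<omega>
            = emeasure (P (X s \<omega>)) (X t -` A \<inter> space M)"

definition semigroup_op ::
  "(ennreal \<Rightarrow> 'a measure) \<Rightarrow> (real \<Rightarrow> 'a \<Rightarrow> ennreal) \<Rightarrow> real \<Rightarrow>
   (ennreal \<Rightarrow> ennreal) \<Rightarrow> ennreal \<Rightarrow> ennreal" where
  "semigroup_op P X t f x = (\<integral>\<^sup>+ \<omega>. f (X t \<omega>) \<partial>P x)"

text \<open>
  The constructors stand for \<open>0\<^sup>+ \<cdot> \<infinity>\<close>, \<open>0 \<cdot> \<infinity>\<^sup>-\<close> and for \<open>\<infinity> \<cdot> 0\<^sup>+\<close>, \<open>\<infinity>\<^sup>- \<cdot> 0\<close>, in this order;
  the first factor refers to \<open>X\<close>, the second to \<open>Y\<close>.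
\<close>

datatype star1 = ZeroPlus_Infty | Zero_InftyMinus
datatype star2 = Infty_ZeroPlus | InftyMinus_Zero

definition exp_neg :: "ennreal \<Rightarrow> ennreal" where
  "exp_neg z = (if z = \<infinity> then 0 else ennreal (exp (- enn2real z)))"

text \<open>
  \<open>laplace_kernel s1 s2 x y\<close> is \<open>e\<^bsup>-xy\<^esup>\<close> under the conventions \<open>s1\<close>, \<open>s2\<close>. Outside the two
  indeterminate products the multiplication of \<^typ>\<open>ennreal\<close> already satisfies
  \<open>x * \<infinity> = \<infinity> * x = \<infinity>\<close> for \<open>x > 0\<close>.
\<close>

definition laplace_kernel :: "star1 \<Rightarrow> star2 \<Rightarrow> ennreal \<Rightarrow> ennreal \<Rightarrow> ennreal" where
  "laplace_kernel s1 s2 x y =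
     (if x = 0 \<and> y = \<infinity> then (case s1 of ZeroPlus_Infty \<Rightarrow> 0 | Zero_InftyMinus \<Rightarrow> 1)
      else if x = \<infinity> \<and> y = 0 then (case s2 of Infty_ZeroPlus \<Rightarrow> 0 | InftyMinus_Zero \<Rightarrow> 1)
      else exp_neg (x * y))"

definition laplace_dual ::
  "star1 \<Rightarrow> star2 \<Rightarrow> (ennreal \<Rightarrow> 'a measure) \<Rightarrow> (real \<Rightarrow> 'a \<Rightarrow> ennreal) \<Rightarrow>
   (ennreal \<Rightarrow> 'b measure) \<Rightarrow> (real \<Rightarrow> 'b \<Rightarrow> ennreal) \<Rightarrow> bool" where
  "laplace_dual s1 s2 P X Q Y \<longleftrightarrow>
     (\<forall>t\<ge>0. \<forall>x y. (\<integral>\<^sup>+ \<omega>. laplace_kernel s1 s2 (X t \<omega>) y \<partial>P x)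
                = (\<integral>\<^sup>+ \<omega>. laplace_kernel s1 s2 x (Y t \<omega>) \<partial>Q y))"

definition excessive_measure ::
  "real \<Rightarrow> (ennreal \<Rightarrow> 'b measure) \<Rightarrow> (real \<Rightarrow> 'b \<Rightarrow> ennreal) \<Rightarrow> ennreal measure \<Rightarrow> bool" where
  "excessive_measure \<theta> Q Y \<mu> \<longleftrightarrow>
     sets \<mu> = sets borel \<and> sigma_finite_measure \<mu> \<and>
     (\<forall>t\<ge>0. \<forall>\<phi>\<in>borel_measurable borel.
        (\<integral>\<^sup>+ y. semigroup_op Q Y t \<phi> y \<partial>\<mu>) \<le> ennreal (exp (\<theta> * t)) * (\<integral>\<^sup>+ y. \<phi> y \<partial>\<mu>))"

definition invariant_measure ::
  "real \<Rightarrow> (ennreal \<Rightarrow> 'b measure) \<Rightarrow> (real \<Rightarrow> 'b \<Rightarrow> ennreal) \<Rightarrow> ennreal measure \<Rightarrow> bool" where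
  "invariant_measure \<theta> Q Y \<mu> \<longleftrightarrow>
     sets \<mu> = sets borel \<and> sigma_finite_measure \<mu> \<and>
     (\<forall>t\<ge>0. \<forall>\<phi>\<in>borel_measurable borel.
        (\<integral>\<^sup>+ y. semigroup_op Q Y t \<phi> y \<partial>\<mu>) = ennreal (exp (\<theta> * t)) * (\<integral>\<^sup>+ y. \<phi> y \<partial>\<mu>))"

definition excessive_function ::
  "real \<Rightarrow> (ennreal \<Rightarrow> 'a measure) \<Rightarrow> (real \<Rightarrow> 'a \<Rightarrow> ennreal) \<Rightarrow> (ennreal \<Rightarrow> ennreal) \<Rightarrow> bool" where
  "excessive_function \<theta> P X f \<longleftrightarrow>
     f \<in> borel_measurable borel \<and>
     (\<forall>t\<ge>0. \<forall>x. semigroup_op P X t f x \<le> ennreal (exp (\<theta> * t)) * f x)"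

definition invariant_function ::
  "real \<Rightarrow> (ennreal \<Rightarrow> 'a measure) \<Rightarrow> (real \<Rightarrow> 'a \<Rightarrow> ennreal) \<Rightarrow> (ennreal \<Rightarrow> ennreal) \<Rightarrow> bool" where
  "invariant_function \<theta> P X f \<longleftrightarrow>
     f \<in> borel_measurable borel \<and>
     (\<forall>t\<ge>0. \<forall>x. semigroup_op P X t f x = ennreal (exp (\<theta> * t)) * f x)"

definition f_down :: "star1 \<Rightarrow> star2 \<Rightarrow> ennreal measure \<Rightarrow> ennreal \<Rightarrow> ennreal" where
  "f_down s1 s2 \<mu> x = (\<integral>\<^sup>+ y. laplace_kernel s1 s2 x y \<partial>\<mu>)"

definition f_up :: "star1 \<Rightarrow> star2 \<Rightarrow> ennreal measure \<Rightarrow> ennreal \<Rightarrow> ennreal" where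
  "f_up s1 s2 \<mu> x = (\<integral>\<^sup>+ y. (1 - laplace_kernel s1 s2 x y) \<partial>\<mu>)"

end

theory Submission
  imports Defs
begin

text \<open>
  Fix a kernel \<open>h \<ge> 0\<close> that intertwines the two processes,
  \<open>\<E>\<^sub>x[h(X\<^sub>t, y)] = \<E>\<^sup>y[h(x, Y\<^sub>t)]\<close>, and is jointly measurable, and put \<open>f(x) = \<integral> h(x, y) \<mu>(dy)\<close>.
  Since \<open>\<mu>\<close> is \<open>\<sigma>\<close>-finite, Tonelli's theorem gives
  \<open>P\<^sub>t f(x) = \<integral> \<E>\<^sub>x[h(X\<^sub>t, y)] \<mu>(dy) = \<integral> Q\<^sub>t h(x, \<sqdot>) d\<mu>\<close>
  (lemma \<open>semigroup_op_dual_integral\<close>), and the excessivity or invariance of \<open>\<mu>\<close>, applied to the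
  function \<open>h(x, \<sqdot>)\<close>, is exactly the corresponding property of \<open>f\<close> at the point \<open>x\<close>.

  The Laplace kernel is such an \<open>h\<close> by hypothesis. As it takes values in \<open>[0, 1]\<close> and the laws
  have total mass \<open>1\<close>, the complementary kernel \<open>1 - e\<^bsup>-xy\<^esup>\<close> is another one. Monotonicity of the
  two functions comes from that of the kernels: under each of the four conventions
  \<open>x \<mapsto> e\<^bsup>-xy\<^esup>\<close> is nonincreasing on all of \<open>[0, \<infinity>]\<close>, for every \<open>y \<in> [0, \<infinity>]\<close>
  (lemma \<open>laplace_kernel_antimono\<close>).
\<close>

lemma exp_neg_le_1: "exp_neg z \<le> 1"
  by (auto simp: exp_neg_def ennreal_le_1)

lemma exp_neg_antimono:
  assumes "z \<le> w"
  shows "exp_neg w \<le> exp_neg z"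
proof (cases "w = \<infinity>")
  case True
  then show ?thesis by (simp add: exp_neg_def)
next
  case False
  with assms have "z \<noteq> \<infinity>" and "enn2real z \<le> enn2real w"
    by (auto simp: top_unique less_top intro!: enn2real_mono)
  with False show ?thesis by (simp add: exp_neg_def ennreal_leI)
qed

lemma borel_measurable_exp_neg [measurable]: "exp_neg \<in> borel_measurable borel"
  unfolding exp_neg_def[abs_def] by measurable

lemma laplace_kernel_le_1: "laplace_kernel s1 s2 x y \<le> 1"
  by (auto simp: laplace_kernel_def exp_neg_le_1 split: star1.split star2.split)

lemma laplace_kernel_antimono:
  assumes "x \<le> x'"
  shows "laplace_kernel s1 s2 x' y \<le> laplace_kernel s1 s2 x y"
proof -
  have prod: "exp_neg (x' * y) \<le> exp_neg (x * y)"
    by (intro exp_neg_antimono mult_right_mono assms) simp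
  consider "x = x'" | "y = \<infinity>" "x < x'" | "y = 0" "x < x'" | "y \<noteq> \<infinity>" "y \<noteq> 0"
    using assms by fastforce
  then show ?thesis
  proof cases
    case 2
    then have "x' \<noteq> 0" by auto
    with 2 have "laplace_kernel s1 s2 x' y = 0"
      by (simp add: laplace_kernel_def exp_neg_def ennreal_mult_top)
    then show ?thesis by simp
  next
    case 3
    then have "x \<noteq> \<infinity>" by auto
    with 3 have "laplace_kernel s1 s2 x y = 1"
      by (simp add: laplace_kernel_def exp_neg_def)
    then show ?thesis by (simp add: laplace_kernel_le_1)
  next
    case 4
    then show ?thesis using prod by (simp add: laplace_kernel_def)
  qed simp
qed

lemma borel_measurable_laplace_kernel:
  "(\<lambda>(x, y). laplace_kernel s1 s2 x y) \<in> borel_measurable (borel \<Otimes>\<^sub>M borel)"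
  unfolding laplace_kernel_def by (cases s1; cases s2) simp_all

lemma borel_measurable_laplace_kernel_comp [measurable (raw)]:
  assumes "f \<in> borel_measurable L" "g \<in> borel_measurable L"
  shows "(\<lambda>\<omega>. laplace_kernel s1 s2 (f \<omega>) (g \<omega>)) \<in> borel_measurable L"
  using measurable_compose[OF measurable_Pair[OF assms] borel_measurable_laplace_kernel]
  by simp

lemma antimono_f_down: "antimono (f_down s1 s2 \<mu>)"
  unfolding f_down_def by (intro antimonoI nn_integral_mono laplace_kernel_antimono)

lemma mono_f_up: "mono (f_up s1 s2 \<mu>)"
  unfolding f_up_def
  by (intro monoI nn_integral_mono ennreal_minus_mono laplace_kernel_antimono order_refl)

context positive_markov_process
begin

lemma measurable_X_P: "0 \<le> t \<Longrightarrow> X t \<in> borel_measurable (P x)"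
  using measurable_X[of t] measurable_cong_sets[OF sets_P refl] by blast

text \<open>
  Passing from a kernel bounded by \<open>1\<close> to its complement commutes with taking expectations, because
  the laws have total mass \<open>1\<close>.
\<close>

lemma nn_integral_one_minus:
  assumes "0 \<le> t" and "g \<in> borel_measurable borel" and "\<And>z. g z \<le> 1"
  shows "(\<integral>\<^sup>+ \<omega>. (1 - g (X t \<omega>)) \<partial>P x) = 1 - (\<integral>\<^sup>+ \<omega>. g (X t \<omega>) \<partial>P x)"
proof -
  interpret prob_space "P x" by (rule prob_space_P)
  have [measurable]: "X t \<in> borel_measurable (P x)" using assms(1) by (rule measurable_X_P)
  note [measurable] = assms(2)
  have "(\<integral>\<^sup>+ \<omega>. g (X t \<omega>) \<partial>P x) \<le> (\<integral>\<^sup>+ \<omega>. 1 \<partial>P x)"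
    by (intro nn_integral_mono assms(3))
  then have "(\<integral>\<^sup>+ \<omega>. g (X t \<omega>) \<partial>P x) \<noteq> \<infinity>"
    by (auto simp: emeasure_space_1 top_unique)
  then have "(\<integral>\<^sup>+ \<omega>. (1 - g (X t \<omega>)) \<partial>P x) = (\<integral>\<^sup>+ \<omega>. 1 \<partial>P x) - (\<integral>\<^sup>+ \<omega>. g (X t \<omega>) \<partial>P x)"
    by (intro nn_integral_diff) (simp_all add: assms(3))
  then show ?thesis by (simp add: emeasure_space_1)
qed

lemma semigroup_op_dual_integral:
  fixes Q :: "ennreal \<Rightarrow> 'b measure" and Y :: "real \<Rightarrow> 'b \<Rightarrow> ennreal"
    and h :: "ennreal \<Rightarrow> ennreal \<Rightarrow> ennreal"
  assumes "0 \<le> t" and "sigma_finite_measure \<mu>" and \<mu>: "sets \<mu> = sets borel"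
    and h: "(\<lambda>(x, y). h x y) \<in> borel_measurable (borel \<Otimes>\<^sub>M borel)"
    and dual: "\<And>y. (\<integral>\<^sup>+ \<omega>. h (X t \<omega>) y \<partial>P x) = (\<integral>\<^sup>+ \<omega>. h x (Y t \<omega>) \<partial>Q y)"
  shows "semigroup_op P X t (\<lambda>x. \<integral>\<^sup>+ y. h x y \<partial>\<mu>) x = (\<integral>\<^sup>+ y. semigroup_op Q Y t (h x) y \<partial>\<mu>)"
proof -
  interpret prob_space "P x" by (rule prob_space_P)
  interpret sigma_finite_measure \<mu> by fact
  interpret pair_sigma_finite "P x" \<mu> ..
  have [measurable]: "X t \<in> borel_measurable (P x)" using assms(1) by (rule measurable_X_P)
  have [measurable]: "(\<lambda>y. y) \<in> measurable \<mu> borel" by (simp add: measurable_ident_sets[OF \<mu>])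
  have joint: "(\<lambda>(\<omega>, y). h (X t \<omega>) y) \<in> borel_measurable (P x \<Otimes>\<^sub>M \<mu>)"
    using measurable_compose[OF _ h, of "\<lambda>p. (X t (fst p), snd p)" "P x \<Otimes>\<^sub>M \<mu>"]
    by (simp add: split_beta')
  have "(\<integral>\<^sup>+ \<omega>. (\<integral>\<^sup>+ y. h (X t \<omega>) y \<partial>\<mu>) \<partial>P x) = (\<integral>\<^sup>+ y. (\<integral>\<^sup>+ \<omega>. h (X t \<omega>) y \<partial>P x) \<partial>\<mu>)"
    by (rule Fubini'[OF joint, symmetric])
  then show ?thesis by (simp add: semigroup_op_def dual)
qed

lemma
  fixes Q :: "ennreal \<Rightarrow> 'b measure" and Y :: "real \<Rightarrow> 'b \<Rightarrow> ennreal"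
    and h :: "ennreal \<Rightarrow> ennreal \<Rightarrow> ennreal"
  assumes h: "(\<lambda>(x, y). h x y) \<in> borel_measurable (borel \<Otimes>\<^sub>M borel)"
    and dual: "\<And>t x y. 0 \<le> t \<Longrightarrow>
          (\<integral>\<^sup>+ \<omega>. h (X t \<omega>) y \<partial>P x) = (\<integral>\<^sup>+ \<omega>. h x (Y t \<omega>) \<partial>Q y)"
  shows excessive_function_dual_integral:
      "excessive_measure \<theta> Q Y \<mu> \<Longrightarrow> excessive_function \<theta> P X (\<lambda>x. \<integral>\<^sup>+ y. h x y \<partial>\<mu>)"
    and invariant_function_dual_integral:
      "invariant_measure \<theta> Q Y \<mu> \<Longrightarrow> invariant_function \<theta> P X (\<lambda>x. \<integral>\<^sup>+ y. h x y \<partial>\<mu>)"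
proof -
  have h_x: "h x \<in> borel_measurable borel" for x
    using measurable_compose[OF measurable_Pair1' h, of x] by simp
  have meas: "(\<lambda>x. \<integral>\<^sup>+ y. h x y \<partial>\<mu>) \<in> borel_measurable borel"
    if "sigma_finite_measure \<mu>" "sets \<mu> = sets borel"
  proof -
    interpret sigma_finite_measure \<mu> by fact
    have "sets (borel \<Otimes>\<^sub>M \<mu>) = sets (borel \<Otimes>\<^sub>M (borel :: ennreal measure))"
      using that(2) by (intro sets_pair_measure_cong) simp_all
    then have "(\<lambda>(x, y). h x y) \<in> borel_measurable (borel \<Otimes>\<^sub>M \<mu>)"
      using h measurable_cong_sets by blast
    then show ?thesis by (rule borel_measurable_nn_integral)
  qed
  show "excessive_function \<theta> P X (\<lambda>x. \<integral>\<^sup>+ y. h x y \<partial>\<mu>)" if "excessive_measure \<theta> Q Y \<mu>"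
    using that
    by (auto simp: excessive_measure_def excessive_function_def meas h_x
        semigroup_op_dual_integral[OF _ _ _ h dual])
  show "invariant_function \<theta> P X (\<lambda>x. \<integral>\<^sup>+ y. h x y \<partial>\<mu>)" if "invariant_measure \<theta> Q Y \<mu>"
    using that
    by (auto simp: invariant_measure_def invariant_function_def meas h_x
        semigroup_op_dual_integral[OF _ _ _ h dual])
qed

end

theorem proposition3p26:
  fixes M :: "'a measure" and P :: "ennreal \<Rightarrow> 'a measure" and X :: "real \<Rightarrow> 'a \<Rightarrow> ennreal"
    and N :: "'b measure" and Q :: "ennreal \<Rightarrow> 'b measure" and Y :: "real \<Rightarrow> 'b \<Rightarrow> ennreal"
    and s1 :: star1 and s2 :: star2 and \<theta> :: real and \<mu> :: "ennreal measure"
  assumes "positive_markov_process M P X"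
    and "positive_markov_process N Q Y"
    and "laplace_dual s1 s2 P X Q Y"
    and "0 \<le> \<theta>"
  shows "(excessive_measure \<theta> Q Y \<mu> \<longrightarrow>
            antimono (f_down s1 s2 \<mu>) \<and> excessive_function \<theta> P X (f_down s1 s2 \<mu>) \<and>
            mono (f_up s1 s2 \<mu>) \<and> excessive_function \<theta> P X (f_up s1 s2 \<mu>)) \<and>
         (invariant_measure \<theta> Q Y \<mu> \<longrightarrow>
            antimono (f_down s1 s2 \<mu>) \<and> invariant_function \<theta> P X (f_down s1 s2 \<mu>) \<and>
            mono (f_up s1 s2 \<mu>) \<and> invariant_function \<theta> P X (f_up s1 s2 \<mu>))"
proof -
  interpret X: positive_markov_process M P X by fact
  interpret Y: positive_markov_process N Q Y by fact
  let ?k = "laplace_kernel s1 s2"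
  have dual: "(\<integral>\<^sup>+ \<omega>. ?k (X t \<omega>) y \<partial>P x) = (\<integral>\<^sup>+ \<omega>. ?k x (Y t \<omega>) \<partial>Q y)" if "0 \<le> t" for t x y
    using assms(3) that by (simp add: laplace_dual_def)
  have dual': "(\<integral>\<^sup>+ \<omega>. (1 - ?k (X t \<omega>) y) \<partial>P x) = (\<integral>\<^sup>+ \<omega>. (1 - ?k x (Y t \<omega>)) \<partial>Q y)"
    if "0 \<le> t" for t x y
  proof -
    have "(\<integral>\<^sup>+ \<omega>. (1 - ?k (X t \<omega>) y) \<partial>P x) = 1 - (\<integral>\<^sup>+ \<omega>. ?k (X t \<omega>) y \<partial>P x)"
      by (rule X.nn_integral_one_minus) (auto simp: that laplace_kernel_le_1)
    moreover have "(\<integral>\<^sup>+ \<omega>. (1 - ?k x (Y t \<omega>)) \<partial>Q y) = 1 - (\<integral>\<^sup>+ \<omega>. ?k x (Y t \<omega>) \<partial>Q y)"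
      by (rule Y.nn_integral_one_minus) (auto simp: that laplace_kernel_le_1)
    ultimately show ?thesis using dual[OF that] by simp
  qed
  have k': "(\<lambda>(x, y). 1 - ?k x y) \<in> borel_measurable (borel \<Otimes>\<^sub>M borel)" by measurable
  have down: "f_down s1 s2 \<mu> = (\<lambda>x. \<integral>\<^sup>+ y. ?k x y \<partial>\<mu>)" by (simp add: fun_eq_iff f_down_def)
  have up: "f_up s1 s2 \<mu> = (\<lambda>x. \<integral>\<^sup>+ y. (1 - ?k x y) \<partial>\<mu>)" by (simp add: fun_eq_iff f_up_def)
  have "excessive_function \<theta> P X (f_down s1 s2 \<mu>)" "excessive_function \<theta> P X (f_up s1 s2 \<mu>)"
    if "excessive_measure \<theta> Q Y \<mu>"
    unfolding down up
    by (rule X.excessive_function_dual_integral[OF _ _ that];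
        fact borel_measurable_laplace_kernel k' dual dual')+
  moreover have "invariant_function \<theta> P X (f_down s1 s2 \<mu>)" "invariant_function \<theta> P X (f_up s1 s2 \<mu>)"
    if "invariant_measure \<theta> Q Y \<mu>"
    unfolding down up
    by (rule X.invariant_function_dual_integral[OF _ _ that];
        fact borel_measurable_laplace_kernel k' dual dual')+
  ultimately show ?thesis using antimono_f_down mono_f_up by blast
qed

end
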